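(* Let $v\ge1$ and $q\ge 0$ be integers. If a design $\mathcal D$ with $v$ pools on $n$ objects satisfies $\hat{\mathcal D}\in\mathcal S^v_{2,q}$, then $$n\le \binom{v}{t^*}\binom{2t^*+q-1}{t^*}^{-1},$$ where $t^*$ is the least integer $t$ such that $$v\le 5t+2+\frac{q(q-1)}{t+q};$$ in particular $t^*=\lceil (v-2)/5\rceil$ if $q=0$ or $q=1$.
   Context: A design with $v$ pools on $n$ objects is a list $\mathcal D=(A_1,\dots,A_v)$ of subsets of $\{1,\dots,n\}$. Its dual is $\hat{\mathcal D}=(B_1,\dots,B_n)$ where $B_i=\{j\in\{1,\dots,v\}: i\in A_j\}$; $n$ is the number of members of $\hat{\mathcal D}$. For $A\subseteq\{1,\dots,n\}$ let $\phi(A)=\bigcup_{i\in A}B_i$ ($\phi(\emptyset)=\emptyset$). For integers $p,q\ge0$, $\mathcal D$ is a $(p,q)$-solution if $|\phi(A)\triangle\phi(A')|>q$ for all $A,A'\subseteq\{1,\dots,n\}$ with $A\ne A'$ and $|A|\le p$ ($\triangle$ = symmetric difference). $\mathcal S^v_{p,q}$ is the set of duals of $(p,q)$-solutions with $v$ pools, i.e. the families $(B_1,\dots,B_n)$ of subsets of $\{1,\dots,v\}$ satisfying this condition.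
   Formalization: t* is the least integer t ≥ 0 with t+q > 0 satisfying the inequality; the formula t* = ⌈(v-2)/5⌉ is claimed for q = 1, and for q = 0 only if v ≥ 3, since for q = 0, v = 2 it would give t* = 0 and n ≤ 1, though D = ({1},{2}) has n = 2. *)

theory Defs
  imports Complex_Main
begin

text \<open>
  Families of sets are lists. Pools and objects are numbered from 1, so that the member with
  number \<open>i\<close> of a family \<open>F\<close> is \<open>F ! (i - 1)\<close>.
\<close>

definition is_design :: "nat \<Rightarrow> nat \<Rightarrow> nat set list \<Rightarrow> bool" where
  "is_design v n D \<longleftrightarrow> length D = v \<and> (\<forall>A \<in> set D. A \<subseteq> {1..n})"

text \<open>The number \<open>n\<close> of objects is an argument since it cannot be read off the list of pools.\<close>

definition design_dual :: "nat \<Rightarrow> nat set list \<Rightarrow> nat set list" where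
  "design_dual n D = map (\<lambda>i. {j \<in> {1..length D}. i \<in> D ! (j - 1)}) [1..<n + 1]"

definition phi :: "nat set list \<Rightarrow> nat set \<Rightarrow> nat set" where
  "phi B A = (\<Union>i\<in>A. B ! (i - 1))"

definition pq_solution :: "nat \<Rightarrow> nat \<Rightarrow> nat \<Rightarrow> nat set list \<Rightarrow> bool" where
  "pq_solution p q n D \<longleftrightarrow>
     (\<forall>A A'. A \<subseteq> {1..n} \<longrightarrow> A' \<subseteq> {1..n} \<longrightarrow> A \<noteq> A' \<longrightarrow> card A \<le> p \<longrightarrow>
        card (sym_diff (phi (design_dual n D) A) (phi (design_dual n D) A')) > q)"

definition dual_solutions :: "nat \<Rightarrow> nat \<Rightarrow> nat \<Rightarrow> nat set list set" where
  "dual_solutions v p q = {design_dual n D | n D. is_design v n D \<and> pq_solution p q n D}"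

text \<open>
  The conjunct \<open>0 < t + q\<close> says that the quotient is defined. It only excludes \<open>t = 0\<close> when
  \<open>q = 0\<close>, where division by zero in HOL would make the inequality read \<open>v \<le> 2\<close>.
\<close>

definition tstar_ineq :: "nat \<Rightarrow> nat \<Rightarrow> nat \<Rightarrow> bool" where
  "tstar_ineq v q t \<longleftrightarrow>
     0 < t + q \<and> real v \<le> 5 * real t + 2 + real q * (real q - 1) / (real t + real q)"

definition tstar :: "nat \<Rightarrow> nat \<Rightarrow> nat" where
  "tstar v q = (LEAST t. tstar_ineq v q t)"

lemma tstar_ineq_tstar: "tstar_ineq v q (tstar v q)"
proof -
  have "real q * (real q - 1) \<ge> 0"
    by (cases q) auto
  then have "real q * (real q - 1) / (real (Suc v) + real q) \<ge> 0"
    by simp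
  then have "tstar_ineq v q (Suc v)"
    unfolding tstar_ineq_def by simp
  then show ?thesis
    unfolding tstar_def by (rule LeastI)
qed

lemma tstar_le: "tstar_ineq v q t \<Longrightarrow> tstar v q \<le> t"
  unfolding tstar_def by (rule Least_le)

end

theory Submission
  imports Defs "HOL-Combinatorics.Multiset_Permutations"
begin

text \<open>
  Call a subset of a block \<open>B\<^sub>c\<close> private if no other block contains it. Reading a permutation of
  the points from left to right, its prefixes form a chain, and a chain cannot meet private subsets
  of two different blocks. Hence the probabilities that a random permutation has a prefix
  private to \<open>B\<^sub>c\<close> sum to at most 1 over all \<open>c\<close>, and it suffices to show that each of them is at least
  \<open>w(t) = (2t+q-1 choose t) / (v choose t)\<close> for some \<open>t\<close>: the ratio \<open>w(t+1) / w(t)\<close> is at least 1 exactly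
  when \<open>v \<le> 5t + 2 + q(q-1)/(t+q)\<close>, so \<open>w\<close> is smallest at \<open>t\<^sup>*\<close>.

  Two non-private subsets of a block of size \<open>k\<close> have a union of size less than \<open>k - q\<close>. If
  \<open>k = 2t + q\<close>, the non-private \<open>t\<close>-subsets thus intersect pairwise, and the Erdos-Ko-Rado theorem leaves
  at least \<open>(k-1 choose t)\<close> private ones. If \<open>k = 2t + q - 1\<close>, they intersect pairwise in two points.
  The \<open>(t-1)\<close>-subsets of the block disjoint from some non-private \<open>t\<close>-subset are then private. The
  permutations that have one of these as a prefix and leave the block at the next step make up for
  the missing \<open>t\<close>-subsets, except when \<open>v\<close> is so small that \<open>w(t-1)\<close> is a lower bound instead.
\<close>

section \<open>Intersecting families\<close>

lemma card_permutations_prefix: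
  assumes "finite V" and "T \<subseteq> V"
  shows "card {xs \<in> permutations_of_set V. set (take (card T) xs) = T}
    = fact (card T) * fact (card V - card T)"
proof -
  have fT: "finite T"
    using assms finite_subset by blast
  have "bij_betw (\<lambda>(as, bs). as @ bs) (permutations_of_set T \<times> permutations_of_set (V - T))
      {xs \<in> permutations_of_set V. set (take (card T) xs) = T}"
  proof (rule bij_betwI[where g = "\<lambda>xs. (take (card T) xs, drop (card T) xs)"])
    show "(\<lambda>xs. (take (card T) xs, drop (card T) xs))
        \<in> {xs \<in> permutations_of_set V. set (take (card T) xs) = T}
          \<rightarrow> permutations_of_set T \<times> permutations_of_set (V - T)"
    proof (rule funcsetI)
      fix xs assume "xs \<in> {xs \<in> permutations_of_set V. set (take (card T) xs) = T}"
      then have xs: "distinct xs" "set xs = V" "set (take (card T) xs) = T"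
        by (auto simp: permutations_of_set_def)
      have "set xs = set (take (card T) xs) \<union> set (drop (card T) xs)"
        by (metis append_take_drop_id set_append)
      moreover have "set (take (card T) xs) \<inter> set (drop (card T) xs) = {}"
        using xs(1) by (simp add: set_take_disj_set_drop_if_distinct)
      ultimately have "set (drop (card T) xs) = V - T"
        using xs by auto
      then show "(take (card T) xs, drop (card T) xs)
          \<in> permutations_of_set T \<times> permutations_of_set (V - T)"
        using xs by (auto simp: permutations_of_set_def)
    qed
  qed (use assms in \<open>auto simp: permutations_of_set_def distinct_card\<close>)
  then have "card {xs \<in> permutations_of_set V. set (take (card T) xs) = T}
      = card (permutations_of_set T \<times> permutations_of_set (V - T))"
    by (simp add: bij_betw_same_card)
  then show ?thesis
    using assms fT by (simp add: card_cartesian_product card_Diff_subset)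
qed

text \<open>Such a permutation is an ordering of \<open>T\<close>, then \<open>y\<close>, then an
  ordering of the rest. This counts the permutations that leave a block right after the prefix
  \<open>T\<close>.\<close>

lemma card_permutations_prefix_step:
  assumes "finite V" and "T \<subseteq> V" and "y \<in> V - T"
  shows "card {xs \<in> permutations_of_set V. set (take (card T) xs) = T \<and> xs ! card T = y}
    = fact (card T) * fact (card V - Suc (card T))"
proof -
  have fT: "finite T"
    using assms finite_subset by blast
  have "bij_betw (\<lambda>(as, bs). as @ y # bs)
      (permutations_of_set T \<times> permutations_of_set (V - insert y T))
      {xs \<in> permutations_of_set V. set (take (card T) xs) = T \<and> xs ! card T = y}"
  proof (rule bij_betwI[where g = "\<lambda>xs. (take (card T) xs, drop (Suc (card T)) xs)"])
    show "(\<lambda>xs. (take (card T) xs, drop (Suc (card T)) xs))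
        \<in> {xs \<in> permutations_of_set V. set (take (card T) xs) = T \<and> xs ! card T = y}
          \<rightarrow> permutations_of_set T \<times> permutations_of_set (V - insert y T)"
    proof (rule funcsetI)
      fix xs
      assume "xs \<in> {xs \<in> permutations_of_set V. set (take (card T) xs) = T \<and> xs ! card T = y}"
      then have xs: "distinct xs" "set xs = V" "set (take (card T) xs) = T" "xs ! card T = y"
        by (auto simp: permutations_of_set_def)
      have "card T < card V"
        using assms by (intro psubset_card_mono) auto
      then have len: "card T < length xs"
        using xs by (metis distinct_card)
      have dec: "xs = take (card T) xs @ y # drop (Suc (card T)) xs"
        using id_take_nth_drop[OF len] xs(4) by simp
      then have dis: "distinct (take (card T) xs @ y # drop (Suc (card T)) xs)"
        using xs(1) by simp
      moreover have "set (take (card T) xs @ y # drop (Suc (card T)) xs) = V"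
        using dec xs(2) by simp
      ultimately have "set (drop (Suc (card T)) xs) = V - insert y T"
        unfolding set_append distinct_append using xs(3) by auto
      then show "(take (card T) xs, drop (Suc (card T)) xs)
          \<in> permutations_of_set T \<times> permutations_of_set (V - insert y T)"
        using xs by (auto simp: permutations_of_set_def)
    qed
  next
    fix xs
    assume "xs \<in> {xs \<in> permutations_of_set V. set (take (card T) xs) = T \<and> xs ! card T = y}"
    then have xs: "distinct xs" "set xs = V" "xs ! card T = y"
      by (auto simp: permutations_of_set_def)
    have "card T < card V"
      using assms by (intro psubset_card_mono) auto
    then have "card T < length xs"
      using xs by (metis distinct_card)
    from id_take_nth_drop[OF this]
    show "(case (take (card T) xs, drop (Suc (card T)) xs) of (as, bs) \<Rightarrow> as @ y # bs) = xs"
      using xs(3) by simp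
  qed (use assms in \<open>auto simp: permutations_of_set_def distinct_card nth_append\<close>)
  then have "card {xs \<in> permutations_of_set V. set (take (card T) xs) = T \<and> xs ! card T = y}
      = card (permutations_of_set T \<times> permutations_of_set (V - insert y T))"
    by (simp add: bij_betw_same_card)
  moreover have "card (V - insert y T) = card V - Suc (card T)"
    using assms fT by (subst card_Diff_subset) auto
  ultimately show ?thesis
    using assms fT by (simp add: card_cartesian_product)
qed

section \<open>The Erdos-Ko-Rado theorem and a 2-intersecting variant\<close>

text \<open>Katona's cycle lemma. Every other arc meets the one with the first starting point
  \<open>i\<close>, and the possible offsets from \<open>i\<close> fall into \<open>s\<close>
  classes, each containing at most one starting point.\<close>

lemma card_intersecting_arcs_le:
  fixes xs :: "'a list"
  assumes dist: "distinct xs" and len: "2 * s \<le> length xs"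
    and inter: "\<And>S T. S \<in> F \<Longrightarrow> T \<in> F \<Longrightarrow> S \<inter> T \<noteq> {}"
  shows "card {i \<in> {..<length xs}. set (take s (rotate i xs)) \<in> F} \<le> s"
proof -
  define m where "m = length xs"
  define arc where "arc i = (\<lambda>j. (i + j) mod m) ` {..<s}" for i
  define G where "G = {i \<in> {..<m}. set (take s (rotate i xs)) \<in> F}"
  have arc_set: "set (take s (rotate i xs)) = (!) xs ` arc i" if "m > 0" for i
  proof -
    have "set (take s (rotate i xs)) = (!) (rotate i xs) ` {..<s}"
      using len nth_image[of s "rotate i xs"] by (simp add: lessThan_atLeast0)
    also have "\<dots> = (\<lambda>j. xs ! ((i + j) mod m)) ` {..<s}"
      using len that by (intro image_cong) (auto simp: nth_rotate m_def)
    finally show ?thesis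
      by (simp add: arc_def image_image)
  qed
  have meet: "arc i \<inter> arc j \<noteq> {}" if "i \<in> G" "j \<in> G" for i j
  proof -
    have "m > 0" using that by (auto simp: G_def)
    then have "(!) xs ` arc i \<inter> (!) xs ` arc j \<noteq> {}"
      using that inter arc_set by (simp add: G_def)
    moreover have "arc i \<union> arc j \<subseteq> {..<m}"
      using \<open>m > 0\<close> by (auto simp: arc_def)
    moreover have "inj_on ((!) xs) {..<m}"
      using dist by (simp add: m_def inj_on_nth)
    ultimately show ?thesis
      by (auto dest: inj_onD)
  qed
  \<comment> \<open>Either \<open>j\<close> starts inside the arc of \<open>i\<close>, or the arc of
    \<open>j\<close> wraps around the end and reaches \<open>i\<close>.\<close>
  have gap: "j - i < s \<or> m - s < j - i" if mem: "i \<in> G" "j \<in> G" and "i \<le> j" for i j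
  proof -
    have ij: "i < m" "j < m" using mem by (auto simp: G_def)
    obtain a b where ab: "a < s" "b < s" "(i + a) mod m = (j + b) mod m"
      using meet[OF mem] by (auto simp: arc_def)
    have "i + a < 2 * m" "j + b < 2 * m"
      using ij ab len by (auto simp: m_def)
    then have "(i + a - m) mod m = i + a - m" "(j + b - m) mod m = j + b - m"
      by auto
    then have "(if i + a < m then i + a else i + a - m) = (if j + b < m then j + b else j + b - m)"
      using ab(3) mod_if[of "i + a" m] mod_if[of "j + b" m] by metis
    then show ?thesis
      using ij ab len \<open>i \<le> j\<close> by (auto simp: m_def split: if_splits)
  qed
  have fin: "finite G"
    by (simp add: G_def)
  show ?thesis
  proof (cases "G = {}")
    case True
    then show ?thesis
      unfolding G_def m_def by (metis card.empty zero_le)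
  next
    case False
    define i where "i = Min G"
    have i: "i \<in> G" "\<And>j. j \<in> G \<Longrightarrow> i \<le> j"
      using fin False by (auto simp: i_def)
    \<comment> \<open>The arcs with offsets \<open>d\<close> and \<open>d + (m - s)\<close> from \<open>i\<close> are disjoint, so they share a label.\<close>
    define f where "f j = (if j - i < s then j - i else j - i - (m - s))" for j
    have below: "j < m" if "j \<in> G" for j
      using that by (simp add: G_def)
    have "f ` G \<subseteq> {..<s}"
    proof
      fix d assume "d \<in> f ` G"
      then obtain j where "j \<in> G" "d = f j" by blast
      then show "d \<in> {..<s}"
        using gap[OF i(1) \<open>j \<in> G\<close>] i(2)[of j] below[of j] len by (auto simp: f_def m_def)
    qed
    moreover have "inj_on f G"
    proof (rule linorder_inj_onI)
      fix j j' assume j: "j < j'" "j \<in> G" "j' \<in> G"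
      have "j - i < s \<or> m - s < j - i" "j' - i < s \<or> m - s < j' - i"
        "j' - j < s \<or> m - s < j' - j"
        using gap i j by (simp_all add: less_imp_le)
      moreover have "i \<le> j" "j' < m" "2 * s \<le> m"
        using i j below len by (auto simp: m_def)
      ultimately show "f j \<noteq> f j'"
        unfolding f_def using j(1)
        by (cases "j - i < s"; cases "j' - i < s") (simp_all, linarith+)
    qed auto
    ultimately have "card G \<le> card {..<s}"
      by (intro card_inj_on_le) auto
    then show ?thesis
      by (simp add: G_def m_def)
  qed
qed

text \<open>Katona's double count of pairs of a permutation and a rotation of it that starts with a
  member of \<open>F\<close>. For \<open>s >= 1\<close> and nonempty \<open>X\<close> the product
  form is the usual bound by \<open>(card X - 1) choose (s - 1)\<close>.\<close>

lemma Erdos_Ko_Rado: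
  assumes "finite X" and "2 * s \<le> card X"
    and F: "\<And>S. S \<in> F \<Longrightarrow> S \<subseteq> X \<and> card S = s"
    and inter: "\<And>S T. S \<in> F \<Longrightarrow> T \<in> F \<Longrightarrow> S \<inter> T \<noteq> {}"
  shows "card F * card X \<le> s * (card X choose s)"
proof -
  define m where "m = card X"
  define P where "P = permutations_of_set X"
  have finP: "finite P" and cardP: "card P = fact m"
    using assms(1) by (auto simp: P_def m_def)
  have finF: "finite F"
    using F assms(1) by (intro finite_subset[of F "Pow X"]) auto
  \<comment> \<open>Rotation permutes \<open>P\<close>, so each offset contributes as many
    permutations as offset 0.\<close>
  have rot: "card {xs \<in> P. set (take s (rotate i xs)) \<in> F} = card F * (fact s * fact (m - s))"
    for i
  proof -
    have "rotate i ` P \<subseteq> P"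
      by (auto simp: P_def permutations_of_set_def)
    moreover have inj: "inj (rotate i :: 'a list \<Rightarrow> 'a list)"
      unfolding rotate_def by (rule inj_fn[OF inj_rotate1])
    ultimately have "rotate i ` P = P"
      using finP by (intro endo_inj_surj inj_on_subset[OF inj]) auto
    then have "rotate i ` {xs \<in> P. set (take s (rotate i xs)) \<in> F} = {xs \<in> P. set (take s xs) \<in> F}"
      using Compr_image_eq[of "rotate i" P "\<lambda>xs. set (take s xs) \<in> F"] by simp
    moreover have "card (rotate i ` {xs \<in> P. set (take s (rotate i xs)) \<in> F})
        = card {xs \<in> P. set (take s (rotate i xs)) \<in> F}"
      by (rule card_image[OF inj_on_subset[OF inj subset_UNIV]])
    ultimately have "card {xs \<in> P. set (take s (rotate i xs)) \<in> F}
        = card {xs \<in> P. set (take s xs) \<in> F}"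
      by simp
    also have "{xs \<in> P. set (take s xs) \<in> F} = (\<Union>T\<in>F. {xs \<in> P. set (take s xs) = T})"
      by auto
    also have "card \<dots> = (\<Sum>T\<in>F. card {xs \<in> P. set (take s xs) = T})"
      using finF finP by (intro card_UN_disjoint) auto
    also have "\<dots> = (\<Sum>T\<in>F. fact s * fact (m - s))"
    proof (rule sum.cong)
      fix T assume "T \<in> F"
      then show "card {xs \<in> P. set (take s xs) = T} = fact s * fact (m - s)"
        using card_permutations_prefix[OF assms(1), of T] F by (auto simp: P_def m_def)
    qed simp
    finally show ?thesis by simp
  qed
  have "m * (card F * (fact s * fact (m - s)))
      = (\<Sum>i<m. card {xs \<in> P. set (take s (rotate i xs)) \<in> F})"
    by (simp add: rot)
  also have "\<dots> = (\<Sum>i<m. \<Sum>xs\<in>P. of_bool (set (take s (rotate i xs)) \<in> F))"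
    using finP by (simp add: Int_def)
  also have "\<dots> = (\<Sum>xs\<in>P. \<Sum>i<m. of_bool (set (take s (rotate i xs)) \<in> F))"
    by (rule sum.swap)
  also have "\<dots> = (\<Sum>xs\<in>P. card {i \<in> {..<m}. set (take s (rotate i xs)) \<in> F})"
    by (simp add: Int_def)
  also have "\<dots> \<le> (\<Sum>xs\<in>P. s)"
  proof (rule sum_mono)
    fix xs assume "xs \<in> P"
    then have "distinct xs" "length xs = m"
      by (auto simp: P_def permutations_of_set_def m_def distinct_card)
    then show "card {i \<in> {..<m}. set (take s (rotate i xs)) \<in> F} \<le> s"
      using card_intersecting_arcs_le[of xs s F] assms(2) inter by (simp add: m_def)
  qed
  also have "\<dots> = s * (m choose s) * (fact s * fact (m - s))"
    using binomial_fact_lemma[of s m] assms(2) by (simp add: cardP m_def ac_simps)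
  finally have "(card F * m) * (fact s * fact (m - s)) \<le> s * (m choose s) * (fact s * fact (m - s) :: nat)"
    by (simp add: ac_simps)
  then show ?thesis
    by (simp add: m_def)
qed

text \<open>Deleting \<open>x\<close> from the members through \<open>x\<close> leaves an
  intersecting family of \<open>(t-1)\<close>-sets on one point fewer, to which Erdos-Ko-Rado
  applies. Summing over \<open>x\<close> counts each member \<open>t\<close> times.\<close>

lemma card_two_intersecting_le:
  assumes "finite X" and "2 * t \<le> card X + 1"
    and F: "\<And>S. S \<in> F \<Longrightarrow> S \<subseteq> X \<and> card S = t"
    and inter: "\<And>S T. S \<in> F \<Longrightarrow> T \<in> F \<Longrightarrow> 2 \<le> card (S \<inter> T)"
  shows "card F * (card X - 1) \<le> (t - 1) * (card X choose t)"
proof (cases "F = {}")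
  case False
  then obtain S where "S \<in> F" by blast
  then have "2 \<le> t" using inter[of S S] F by auto
  define m where "m = card X"
  have finF: "finite F"
    using F assms(1) by (intro finite_subset[of F "Pow X"]) auto
  have link: "card {S \<in> F. x \<in> S} * (m - 1) \<le> (t - 1) * ((m - 1) choose (t - 1))"
    if x: "x \<in> X" for x
  proof -
    have inj: "inj_on (\<lambda>S. S - {x}) {S \<in> F. x \<in> S}"
      by (rule inj_onI) auto
    have "card ((\<lambda>S. S - {x}) ` {S \<in> F. x \<in> S}) * card (X - {x})
        \<le> (t - 1) * (card (X - {x}) choose (t - 1))"
    proof (rule Erdos_Ko_Rado)
      show "2 * (t - 1) \<le> card (X - {x})"
        using assms x \<open>2 \<le> t\<close> by simp
    next
      fix S assume "S \<in> (\<lambda>S. S - {x}) ` {S \<in> F. x \<in> S}"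
      then show "S \<subseteq> X - {x} \<and> card S = t - 1"
        using F by fastforce
    next
      fix S T assume "S \<in> (\<lambda>S. S - {x}) ` {S \<in> F. x \<in> S}" "T \<in> (\<lambda>S. S - {x}) ` {S \<in> F. x \<in> S}"
      then obtain S' T' where "S' \<in> F" "T' \<in> F" and ST: "S = S' - {x}" "T = T' - {x}"
        by blast
      then have "2 \<le> card (S' \<inter> T')" using inter by blast
      then have "\<not> S' \<inter> T' \<subseteq> {x}"
        using card_mono[of "{x}" "S' \<inter> T'"] by auto
      then show "S \<inter> T \<noteq> {}" using ST by auto
    qed (use assms in auto)
    then show ?thesis
      using inj x assms(1) by (simp add: card_image m_def)
  qed
  have "t * card F * (m - 1) = (\<Sum>S\<in>F. card S) * (m - 1)"
    using F by simp
  also have "(\<Sum>S\<in>F. card S) = (\<Sum>S\<in>F. \<Sum>x\<in>X. of_bool (x \<in> S))"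
  proof (rule sum.cong)
    fix S assume "S \<in> F"
    then have "S = X \<inter> S" using F by blast
    then have "card S = card (X \<inter> S)" by simp
    then show "card S = (\<Sum>x\<in>X. of_bool (x \<in> S))"
      using assms(1) by simp
  qed simp
  also have "\<dots> = (\<Sum>x\<in>X. \<Sum>S\<in>F. of_bool (x \<in> S))"
    by (rule sum.swap)
  also have "\<dots> = (\<Sum>x\<in>X. card {S \<in> F. x \<in> S})"
    using finF by (simp add: Int_def)
  also have "\<dots> * (m - 1) \<le> (\<Sum>x\<in>X. (t - 1) * ((m - 1) choose (t - 1)))"
    unfolding sum_distrib_right using link by (intro sum_mono)
  also have "\<dots> = (t - 1) * (m * ((m - 1) choose (t - 1)))"
    by (simp add: m_def)
  also have "m * ((m - 1) choose (t - 1)) = t * (m choose t)"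
    using \<open>2 \<le> t\<close> times_binomial_minus1_eq[of t m] by simp
  finally have "t * (card F * (m - 1)) \<le> t * ((t - 1) * (m choose t))"
    by (simp add: ac_simps)
  then show ?thesis
    using \<open>2 \<le> t\<close> by (simp add: m_def)
qed simp

section \<open>The weight of a block\<close>

text \<open>The reciprocal of the bound to be proved, as a function of \<open>t\<close>. It is also
  the probability that the first \<open>t\<close> points of a random permutation lie in a given
  block of size \<open>2t + q - 1\<close>.\<close>

definition lym_weight :: "nat \<Rightarrow> nat \<Rightarrow> nat \<Rightarrow> real" where
  "lym_weight v q t = real ((2 * t + q - 1) choose t) / real (v choose t)"

lemma lym_weight_nonneg: "0 \<le> lym_weight v q t"
  by (simp add: lym_weight_def)

text \<open>The ratio of consecutive weights, cross-multiplied. The hypothesis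
  \<open>0 < s + q\<close> keeps the subtraction in \<open>2 * s + q - 1\<close> from being
  truncated.\<close>

lemma lym_weight_Suc:
  assumes "s < v" and "0 < s + q"
  shows "lym_weight v q (Suc s) * ((real s + real q) * (real v - real s))
    = lym_weight v q s * ((2 * real s + real q + 1) * (2 * real s + real q))"
proof -
  define n where "n = 2 * s + q - 1"
  have n: "Suc n = 2 * s + q" using assms(2) by (simp add: n_def)
  then have ns: "Suc n - s = s + q" by simp
  have "(Suc (Suc n) choose Suc s) * Suc s = Suc (Suc n) * (Suc n choose s)"
    using Suc_times_binomial_eq[of "Suc n" s] by simp
  moreover have "(s + q) * (Suc n choose s) = Suc n * (n choose s)"
    using binomial_absorb_comp[of "Suc n" s] ns by simp
  ultimately have "(Suc (Suc n) choose Suc s) * Suc s * (s + q) = Suc (Suc n) * (Suc n * (n choose s))"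
    by (metis mult.assoc mult.commute)
  then have A: "real (Suc (Suc n) choose Suc s) * real (Suc s) * (real s + real q)
      = (2 * real s + real q + 1) * (2 * real s + real q) * real (n choose s)"
    using n arg_cong[of _ _ real]
    by (metis (no_types, opaque_lifting) mult.assoc of_nat_Suc of_nat_add of_nat_mult of_nat_numeral add.commute)
  have "Suc s * (v choose Suc s) = (v - s) * (v choose s)"
    using binomial_absorb_comp[of v s] binomial_absorption[of s v] by simp
  then have "real (Suc s) * real (v choose Suc s) = real (v - s) * real (v choose s)"
    by (metis of_nat_mult)
  then have B: "real (Suc s) * real (v choose Suc s) = (real v - real s) * real (v choose s)"
    using assms(1) by simp
  have pos: "real (v choose s) > 0" "real (v choose Suc s) > 0" "real (Suc s) > 0"
    using assms(1) by auto
  have eq: "2 * Suc s + q - 1 = Suc (Suc n)" using n by simp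
  have "lym_weight v q (Suc s) * ((real s + real q) * (real v - real s)) * real (v choose s)
      * (real (Suc s) * real (v choose Suc s))
    = real (Suc (Suc n) choose Suc s) * real (Suc s) * (real s + real q) * ((real v - real s) * real (v choose s))"
    using pos unfolding lym_weight_def eq by (simp add: field_simps del: of_nat_Suc binomial_Suc_Suc)
  also have "\<dots> = lym_weight v q s * ((2 * real s + real q + 1) * (2 * real s + real q))
      * real (v choose s) * (real (Suc s) * real (v choose Suc s))"
    unfolding A B using pos by (simp add: lym_weight_def n_def field_simps)
  finally show ?thesis
    using pos by simp
qed

section \<open>The threshold \<open>tstar\<close> as the place of the least weight\<close>

text \<open>Clearing the denominator gives the two factors of \<open>lym_weight_Suc\<close>, so for
  \<open>t < v\<close> the inequality says that the weight does not drop from \<open>t\<close> to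
  \<open>t + 1\<close>.\<close>

lemma tstar_ineq_iff:
  "tstar_ineq v q t \<longleftrightarrow> 0 < t + q \<and>
    (real t + real q) * (real v - real t) \<le> (2 * real t + real q + 1) * (2 * real t + real q)"
proof (cases "0 < t + q")
  case True
  then have pos: "real t + real q > 0" by linarith
  have "real v \<le> 5 * real t + 2 + real q * (real q - 1) / (real t + real q) \<longleftrightarrow>
      real v * (real t + real q) \<le> (5 * real t + 2) * (real t + real q) + real q * (real q - 1)"
    using pos by (simp add: field_simps)
  also have "\<dots> \<longleftrightarrow> (real t + real q) * (real v - real t) \<le> (2 * real t + real q + 1) * (2 * real t + real q)"
    by (simp add: algebra_simps)
  finally show ?thesis
    unfolding tstar_ineq_def by simp
qed (simp add: tstar_ineq_def)

text \<open>From \<open>t\<close> to \<open>t + 1\<close> the linear term gains 5, while the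
  fraction loses \<open>q(q-1) / (u(u+1))\<close>, which is at most 1 because
  \<open>q <= u\<close>.\<close>

lemma tstar_ineq_Suc:
  assumes "tstar_ineq v q t"
  shows "tstar_ineq v q (Suc t)"
proof -
  define u where "u = real t + real q"
  have "0 < t + q" using assms by (simp add: tstar_ineq_def)
  then have u: "u \<ge> 1" "real q \<le> u" by (auto simp: u_def)
  have "real q * real q \<le> u * u"
    using u by (intro mult_mono) auto
  then have "real q * (real q - 1) \<le> u * (u + 1)"
    using u(1) by (simp add: algebra_simps)
  then have "real q * (real q - 1) / (u * (u + 1)) \<le> 1"
    using u by simp
  moreover have "real q * (real q - 1) / u - real q * (real q - 1) / (u + 1)
      = real q * (real q - 1) / (u * (u + 1))"
    using u by (simp add: field_simps)
  ultimately have "real q * (real q - 1) / u \<le> 5 + real q * (real q - 1) / (u + 1)"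
    by linarith
  then show ?thesis
    using assms unfolding tstar_ineq_def u_def by (simp add: algebra_simps)
qed

lemma tstar_ineq_mono:
  assumes "tstar_ineq v q t" and "t \<le> t'"
  shows "tstar_ineq v q t'"
  using assms(2,1) by (induction rule: dec_induct) (auto intro: tstar_ineq_Suc)

text \<open>The inequality fails before \<open>tstar\<close> and holds from there on, so the weight
  does not increase up to \<open>tstar\<close> and does not decrease afterwards.\<close>

lemma lym_weight_tstar_le:
  assumes "t \<le> v" and "0 < t + q"
  shows "lym_weight v q (tstar v q) \<le> lym_weight v q t"
proof (cases "tstar v q \<le> t")
  case True
  have "s \<le> v \<Longrightarrow> lym_weight v q (tstar v q) \<le> lym_weight v q s" if "tstar v q \<le> s" for s
    using that
  proof (induction rule: dec_induct)
    case (step s)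
    have "tstar_ineq v q s"
      using step tstar_ineq_mono tstar_ineq_tstar by blast
    then have sq: "0 < s + q" and le:
      "(real s + real q) * (real v - real s) \<le> (2 * real s + real q + 1) * (2 * real s + real q)"
      by (auto simp: tstar_ineq_iff)
    have "lym_weight v q s * ((real s + real q) * (real v - real s))
        \<le> lym_weight v q (Suc s) * ((real s + real q) * (real v - real s))"
      using step le mult_left_mono[OF le lym_weight_nonneg[of v q s]] sq lym_weight_Suc[of s v q] by simp
    moreover have "(real s + real q) * (real v - real s) > 0"
      using step sq by (intro mult_pos_pos) auto
    ultimately have "lym_weight v q s \<le> lym_weight v q (Suc s)"
      by (rule mult_right_le_imp_le)
    then show ?case using step by simp
  qed simp
  then show ?thesis using True assms(1) by blast
next
  case False
  have "t \<le> tstar v q" using False by simp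
  have "lym_weight v q s \<le> lym_weight v q t" if "t \<le> s" "s \<le> tstar v q" for s
    using that
  proof (induction rule: dec_induct)
    case (step s)
    have "\<not> tstar_ineq v q s"
      using step tstar_le[of v q s] by auto
    moreover have sq: "0 < s + q" using step(1) assms(2) by linarith
    ultimately have le:
      "(2 * real s + real q + 1) * (2 * real s + real q) < (real s + real q) * (real v - real s)"
      by (auto simp: tstar_ineq_iff)
    \<comment> \<open>The failed inequality makes \<open>(s + q)(v - s)\<close> positive, which
      yields \<open>s < v\<close> although \<open>tstar\<close> is not yet known to be at most
      \<open>v\<close>.\<close>
    have "0 \<le> (2 * real s + real q + 1) * (2 * real s + real q)" by simp
    then have pos: "(real s + real q) * (real v - real s) > 0"
      using le by linarith
    then have "s < v"
      using sq by (simp add: zero_less_mult_iff)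
    have "lym_weight v q (Suc s) * ((real s + real q) * (real v - real s))
        \<le> lym_weight v q s * ((real s + real q) * (real v - real s))"
      using mult_left_mono[OF less_imp_le[OF le] lym_weight_nonneg[of v q s]]
        lym_weight_Suc[OF \<open>s < v\<close> sq] by simp
    then have "lym_weight v q (Suc s) \<le> lym_weight v q s"
      using pos by (rule mult_right_le_imp_le)
    then show ?case using step by simp
  qed simp
  then show ?thesis using False by simp
qed

text \<open>
  For a block of size \<open>2t + q - 1\<close>: \<open>K\<close> counts its \<open>t\<close>-subsets, \<open>N\<close> the non-private ones among them and
  \<open>S\<close> the \<open>(t-1)\<close>-subsets disjoint from one of the latter. The two alternatives of the conclusion give the
  weights at \<open>t\<close> and at \<open>t - 1\<close>. The last assumption holds for integers.
\<close>
lemma odd_block_numeric: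
  fixes t q v K N S :: real
  assumes t: "2 \<le> t" and q: "0 \<le> q" and v: "2 * t + q - 1 \<le> v"
    and nonneg: "0 \<le> K" "0 \<le> N" "0 \<le> S"
    and N_le: "N * (2 * t + q - 2) \<le> (t - 1) * K"
    and NS: "N * t \<le> S * (t + q)"
    and NS': "t \<le> q + 1 \<Longrightarrow> N * (t * (t + q - 1)) \<le> S * ((t + q) * (t - 1))"
    and int: "3 * t + q - 1 \<le> v \<or> v \<le> 3 * t + q - 2" "t \<le> q + 1 \<or> q + 2 \<le> t"
  defines "L \<equiv> K - N + S * (v - (2 * t + q - 1)) / t"
  shows "K \<le> L \<or> K * ((t + q - 1) * (v - t + 1)) \<le> L * ((2 * t + q - 1) * (2 * t + q - 2))"
proof -
  define d where "d = v - (2 * t + q - 1)"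
  define u where "u = t + q"
  have d: "0 \<le> d" and u: "2 \<le> u" using v t q by (auto simp: d_def u_def)
  have L: "L = K - N + S * d / t" by (simp add: L_def d_def)
  have Sd: "0 \<le> S * d / t" using nonneg d t by simp
  \<comment> \<open>Here \<open>d\<close> counts the points outside the block, and \<open>u\<close>
    those of the block outside a \<open>(t-1)\<close>-subset. In \<open>a\<close> and
    \<open>c\<close> the gain \<open>S * d / t\<close> covers the loss \<open>N\<close>; in
    \<open>b\<close> the bound \<open>N_le\<close> alone yields the weight at \<open>t - 1\<close>;
    in \<open>e\<close> both estimates are combined for that weight.\<close>
  consider (a) "t \<le> q + 1" "3 * t + q - 1 \<le> v" | (b) "t \<le> q + 1" "v \<le> 3 * t + q - 2"
    | (c) "q + 2 \<le> t" "u \<le> d" | (e) "q + 2 \<le> t" "d < u"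
    using int by linarith
  then show ?thesis
  proof cases
    case a
    have "N * (t * (t + q - 1)) \<le> S * ((t + q) * (t - 1))" using NS' a by simp
    also have "\<dots> \<le> S * (t * (t + q - 1))"
      using nonneg q by (intro mult_left_mono) (auto simp: algebra_simps)
    finally have "N \<le> S"
      using t q by (simp add: mult_le_cancel_right)
    also have "S * t \<le> S * d"
      using a nonneg by (intro mult_left_mono) (auto simp: d_def)
    then have "S \<le> S * d / t"
      using t by (simp add: field_simps)
    finally show ?thesis by (simp add: L)
  next
    case b
    have "K * (t + q - 1) \<le> (K - N) * (2 * t + q - 2)"
      using N_le by (simp add: algebra_simps)
    also have "\<dots> \<le> L * (2 * t + q - 2)"
      using Sd t q by (intro mult_right_mono) (auto simp: L)
    finally have *: "K * (t + q - 1) \<le> L * (2 * t + q - 2)" .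
    have "K * (t + q - 1) * (v - t + 1) \<le> K * (t + q - 1) * (2 * t + q - 1)"
      using b nonneg t q by (intro mult_left_mono) auto
    also have "\<dots> \<le> L * (2 * t + q - 2) * (2 * t + q - 1)"
      using * t q by (intro mult_right_mono) auto
    finally show ?thesis by (simp add: ac_simps)
  next
    case c
    have "N \<le> S * u / t" using NS t by (simp add: field_simps u_def)
    also have "\<dots> \<le> S * d / t"
      using c nonneg t by (intro divide_right_mono mult_left_mono) auto
    finally show ?thesis by (simp add: L)
  next
    case e
    define m where "m = 2 * t + q - 2"
    have m: "2 \<le> m" using t q by (simp add: m_def)
    have "u * (N * t) \<le> u * (S * u)" "N * t * d \<le> S * u * d"
      using NS u d by (auto simp: u_def intro: mult_left_mono mult_right_mono)
    then have "N * d \<le> u * (S * d / t)"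
      using t by (simp add: field_simps)
    \<comment> \<open>The gain covers the fraction \<open>d / u\<close> of the loss; what is left is
      estimated by \<open>N_le\<close>.\<close>
    then have "u * K - N * (u - d) \<le> u * L"
      by (simp add: L algebra_simps)
    then have "m * (u * K - N * (u - d)) \<le> m * (u * L)"
      using m by (intro mult_left_mono) auto
    moreover have "N * m * (u - d) \<le> (t - 1) * K * (u - d)"
      using N_le e by (intro mult_right_mono) (auto simp: m_def)
    ultimately have "K * (u * m - (u - d) * (t - 1)) \<le> m * (u * L)"
      by (simp add: algebra_simps)
    then have L_ge: "(m + 1) * (K * (u * m - (u - d) * (t - 1))) \<le> (m + 1) * (m * (u * L))"
      using m by (intro mult_left_mono) auto
    have "0 \<le> m * (m + 1) - 2 * u * (u - 1)"
    proof -
      \<comment> \<open>In terms of \<open>r\<close> and \<open>q\<close> the difference has only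
        nonnegative coefficients; this is where \<open>q + 2 <= t\<close> enters.\<close>
      define r where "r = t - q - 2"
      have "0 \<le> r" and tr: "t = r + q + 2" using e by (auto simp: r_def)
      have "m * (m + 1) - 2 * u * (u - 1) = 2 * r * r + 4 * r * q + 4 * r + q * q + 3 * q + 2"
        by (simp add: m_def u_def tr algebra_simps)
      then show ?thesis using \<open>0 \<le> r\<close> q by simp
    qed
    \<comment> \<open>What remains is affine in \<open>d\<close>, so it is a combination of its values at \<open>d = 0\<close> and \<open>d = u\<close>.\<close>
    then have "0 \<le> d * (m * (m + 1) - 2 * u * (u - 1)) + (u - d) * ((u - 1) * (t - 1))"
      using d e u t by simp
    also have "\<dots> = (m + 1) * (u * m - (u - d) * (t - 1)) - u * ((u - 1) * (u + d))"
      by (simp add: m_def u_def algebra_simps)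
    finally have "K * (u * ((u - 1) * (u + d))) \<le> K * ((m + 1) * (u * m - (u - d) * (t - 1)))"
      using nonneg by (intro mult_left_mono) auto
    then have "u * (K * ((u - 1) * (u + d))) \<le> u * (L * ((m + 1) * m))"
      using L_ge by (simp add: ac_simps)
    then have *: "K * ((u - 1) * (u + d)) \<le> L * ((m + 1) * m)"
      using u by simp
    have eqs: "u + d = v - t + 1" "m + 1 = 2 * t + q - 1"
      by (auto simp: u_def d_def m_def)
    show ?thesis
      using * unfolding eqs by (simp add: u_def m_def)
  qed
qed

section \<open>Permutations with a private prefix\<close>

text \<open>A set in \<open>Q\<close> is a prefix with probability
  \<open>1 / (v choose Suc s)\<close>; a set in \<open>R\<close> followed by a given point has that
  probability divided by \<open>Suc s\<close>. Requiring this point to lie outside \<open>B\<close>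
  keeps the two kinds of event disjoint.\<close>

lemma card_prefix_event_ge:
  assumes V: "finite V" "B \<subseteq> V"
    and own: "\<And>T. T \<in> Q \<Longrightarrow> T \<subseteq> B \<and> card T = Suc s"
    and early: "\<And>T. T \<in> R \<Longrightarrow> T \<subseteq> B \<and> card T = s"
    and E: "finite E"
      "\<And>xs. xs \<in> permutations_of_set V \<Longrightarrow> set (take (Suc s) xs) \<in> Q \<Longrightarrow> xs \<in> E"
      "\<And>xs. xs \<in> permutations_of_set V \<Longrightarrow> set (take s xs) \<in> R \<Longrightarrow> xs \<in> E"
    and s: "s < card V"
  shows "(real (card Q) + real (card R) * (real (card V) - real (card B)) / real (Suc s)) * fact (card V)
    \<le> real (card E) * real (card V choose Suc s)"
proof -
  define v where "v = card V"
  define P where "P = permutations_of_set V"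
  define E1 where "E1 = (\<Union>T\<in>Q. {xs \<in> P. set (take (Suc s) xs) = T})"
  define E2 where
    "E2 = (\<Union>(T, y)\<in>R \<times> (V - B). {xs \<in> P. set (take s xs) = T \<and> xs ! s = y})"
  have finP: "finite P" by (simp add: P_def)
  have finB: "finite B" using V finite_subset by blast
  have finQ: "finite Q"
    using own finB by (intro finite_subset[of Q "Pow B"]) auto
  have finR: "finite R"
    using early finB by (intro finite_subset[of R "Pow B"]) auto
  have "card E1 = (\<Sum>T\<in>Q. card {xs \<in> P. set (take (Suc s) xs) = T})"
    unfolding E1_def using finQ finP by (intro card_UN_disjoint) auto
  also have "\<dots> = (\<Sum>T\<in>Q. fact (Suc s) * fact (v - Suc s))"
  proof (rule sum.cong)
    fix T assume "T \<in> Q"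
    then have "T \<subseteq> V" "card T = Suc s" using own V by auto
    then show "card {xs \<in> P. set (take (Suc s) xs) = T} = fact (Suc s) * fact (v - Suc s)"
      using card_permutations_prefix[OF V(1), of T] unfolding P_def v_def by metis
  qed simp
  finally have c1: "card E1 = card Q * (fact (Suc s) * fact (v - Suc s))" by simp
  have "card E2 = (\<Sum>z\<in>R \<times> (V - B).
      card (case z of (T, y) \<Rightarrow> {xs \<in> P. set (take s xs) = T \<and> xs ! s = y}))"
    unfolding E2_def using finR finP V by (intro card_UN_disjoint) auto
  also have "\<dots> = (\<Sum>z\<in>R \<times> (V - B). fact s * fact (v - Suc s))"
  proof (rule sum.cong)
    fix z assume "z \<in> R \<times> (V - B)"
    then obtain T y where z: "z = (T, y)" "T \<in> R" "y \<in> V - B" by blast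
    then have "T \<subseteq> V" "card T = s" "y \<in> V - T" using early V by auto
    then show "card (case z of (T, y) \<Rightarrow> {xs \<in> P. set (take s xs) = T \<and> xs ! s = y})
        = fact s * fact (v - Suc s)"
      using card_permutations_prefix_step[OF V(1), of T y]
      unfolding P_def v_def z(1) case_prod_conv by metis
  qed simp
  finally have c2: "card E2 = card R * (v - card B) * (fact s * fact (v - Suc s))"
    using V finB by (simp add: card_cartesian_product card_Diff_subset v_def)
  have dis: "E1 \<inter> E2 = {}"
  proof (rule equals0I)
    fix xs assume xs: "xs \<in> E1 \<inter> E2"
    then have "set (take (Suc s) xs) \<subseteq> B" using own by (auto simp: E1_def)
    moreover have "xs \<in> P" using xs by (auto simp: E1_def)
    then have "s < length xs"
      using s by (auto simp: P_def permutations_of_set_def distinct_card)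
    then have "xs ! s \<in> set (take (Suc s) xs)"
      by (simp add: take_Suc_conv_app_nth)
    ultimately show False using xs by (auto simp: E2_def)
  qed
  have "E1 \<union> E2 \<subseteq> E"
    using E by (auto simp: E1_def E2_def P_def)
  then have "card (E1 \<union> E2) \<le> card E"
    using E(1) by (rule card_mono[rotated])
  moreover have "finite E1" "finite E2"
    using finP by (auto simp: E1_def E2_def intro: finite_subset[of _ P])
  ultimately have "card E1 + card E2 \<le> card E"
    using dis by (simp add: card_Un_disjoint)
  then have "real (card E1) + real (card E2) \<le> real (card E)"
    by linarith
  then have le: "real (card Q) * (fact (Suc s) * fact (v - Suc s))
      + real (card R) * (real v - real (card B)) * (fact s * fact (v - Suc s)) \<le> real (card E)"
    unfolding c1 c2 using card_mono[OF V] by (simp add: v_def del: fact_Suc)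
  have "fact v = (fact (Suc s) * fact (v - Suc s) :: real) * real (v choose Suc s)"
    using binomial_fact_lemma[of "Suc s" v] s by (metis Suc_leI of_nat_fact of_nat_mult v_def)
  then have "(real (card Q) + real (card R) * (real v - real (card B)) / real (Suc s)) * fact v
      = (real (card Q) + real (card R) * (real v - real (card B)) / real (Suc s)) *
        (fact (Suc s) * fact (v - Suc s)) * real (v choose Suc s)"
    by (simp only: mult.assoc)
  also have "(real (card Q) + real (card R) * (real v - real (card B)) / real (Suc s)) *
        (fact (Suc s) * fact (v - Suc s))
      = real (card Q) * (fact (Suc s) * fact (v - Suc s))
      + real (card R) * (real v - real (card B)) * (fact s * fact (v - Suc s))"
    by (simp add: field_simps)
  also have "\<dots> * real (v choose Suc s) \<le> real (card E) * real (v choose Suc s)"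
    using le by (intro mult_right_mono) auto
  finally show ?thesis by (simp add: v_def)
qed

section \<open>The weight of a single block, by the parity of its size minus
  \<open>q\<close>\<close>

text \<open>Two disjoint \<open>Suc s\<close>-sets would have a union of size
  \<open>card B - q\<close>, so those in \<open>N\<close> intersect. By Erdos-Ko-Rado there are at
  most \<open>(card B - 1) choose s\<close> of them, and Pascal's rule gives the rest.\<close>

lemma prefix_event_lym_weight_even:
  assumes V: "finite V" "B \<subseteq> V" and B: "card B = 2 * Suc s + q"
    and N: "\<And>S T. S \<in> N \<Longrightarrow> T \<in> N \<Longrightarrow> card (S \<union> T) + q < card B"
  shows "lym_weight (card V) q (Suc s) * fact (card V)
    \<le> real (card {xs \<in> permutations_of_set V. \<exists>j. set (take j xs) \<in> Pow B - N})"
    (is "_ \<le> real (card ?E)")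
proof -
  have finB: "finite B" using V finite_subset by blast
  define A where "A = {T. T \<subseteq> B \<and> card T = Suc s}"
  have finA: "finite A" using finB by (simp add: A_def)
  have cardA: "card A = card B choose Suc s"
    using n_subsets[OF finB] by (simp add: A_def)
  have EKR: "card (A \<inter> N) * card B \<le> Suc s * (card B choose Suc s)"
  proof (rule Erdos_Ko_Rado)
    fix S T assume ST: "S \<in> A \<inter> N" "T \<in> A \<inter> N"
    then have "finite S" "finite T"
      using finB finite_subset by (auto simp: A_def)
    then have "card (S \<union> T) + card (S \<inter> T) = 2 * Suc s" "card (S \<union> T) + q < card B"
      using ST card_Un_Int[of S T] N by (auto simp: A_def)
    then show "S \<inter> T \<noteq> {}" using B by auto
  qed (use finB B in \<open>auto simp: A_def\<close>)
  have absorb: "Suc s * (card B choose Suc s) = card B * ((card B - 1) choose s)"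
    using times_binomial_minus1_eq[of "Suc s" "card B"] by simp
  have "0 < card B" using B by simp
  then have "card (A \<inter> N) \<le> (card B - 1) choose s"
    using EKR unfolding absorb by (simp add: mult.commute)
  moreover have "card B choose Suc s = ((card B - 1) choose s) + ((card B - 1) choose Suc s)"
    using B by (cases "card B") auto
  moreover have "card (A - N) = card A - card (A \<inter> N)"
    using finA by (simp add: card_Diff_subset_Int)
  ultimately have "(2 * Suc s + q - 1) choose Suc s \<le> card (A - N)"
    using cardA B by simp
  then have "real ((2 * Suc s + q - 1) choose Suc s) * fact (card V)
      \<le> real (card (A - N)) * fact (card V)"
    by (intro mult_right_mono) (simp_all del: binomial_Suc_Suc)
  also have "\<dots> \<le> real (card ?E) * real (card V choose Suc s)"
    using card_prefix_event_ge[OF V, of "A - N" s "{}" ?E] card_mono[OF V] B by (auto simp: A_def)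
  finally have "real ((2 * Suc s + q - 1) choose Suc s) * fact (card V)
      \<le> real (card ?E) * real (card V choose Suc s)" .
  moreover have "real (card V choose Suc s) > 0"
    using card_mono[OF V] B by simp
  ultimately show ?thesis
    unfolding lym_weight_def by (simp add: pos_divide_le_eq del: binomial_Suc_Suc)
qed

text \<open>Counting disjoint pairs of a \<open>U\<close> in \<open>A \<inter> N\<close> and a
  \<open>T\<close> in \<open>R\<close> from both sides bounds \<open>card R\<close> from below. The
  witness for \<open>t\<close> is \<open>Suc s\<close> or \<open>s\<close>, according to the
  alternative in \<open>odd_block_numeric\<close>.\<close>

lemma prefix_event_lym_weight_odd:
  assumes V: "finite V" "B \<subseteq> V" and B: "card B = 2 * s + q + 1"
    and N: "\<And>S T. S \<in> N \<Longrightarrow> T \<in> N \<Longrightarrow> card (S \<union> T) + q < card B"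
  shows "\<exists>t \<le> card V. 0 < t + q \<and> lym_weight (card V) q t * fact (card V)
    \<le> real (card {xs \<in> permutations_of_set V. \<exists>j. set (take j xs) \<in> Pow B - N})"
    (is "\<exists>t\<le>_. _ \<and> _ \<le> real (card ?E)")
proof -
  have finB: "finite B" using V finite_subset by blast
  have BV: "card B \<le> card V" using card_mono[OF V] .
  then have sV: "s < card V" using B by simp
  define t where "t = Suc s"
  define A where "A = {T. T \<subseteq> B \<and> card T = t}"
  define R where "R = {T. T \<subseteq> B \<and> card T = s \<and> (\<exists>U\<in>A \<inter> N. U \<inter> T = {})}"
  have finA: "finite A" and finR: "finite R" using finB by (simp_all add: A_def R_def)
  have cardA: "card A = card B choose t"
    using n_subsets[OF finB] by (simp add: A_def)
  define L where "L = real (card (A - N)) + real (card R) * (real (card V) - real (card B)) / real t"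
  have two: "2 \<le> card (S \<inter> T)" if ST: "S \<in> A \<inter> N" "T \<in> A \<inter> N" for S T
  proof -
    have "finite S" "finite T"
      using ST finB finite_subset by (auto simp: A_def)
    then have "card (S \<union> T) + card (S \<inter> T) = 2 * t" "card (S \<union> T) + q < card B"
      using ST card_Un_Int[of S T] N by (auto simp: A_def)
    then show ?thesis using B by (simp add: t_def)
  qed
  \<comment> \<open>A member of \<open>N\<close> disjoint from some \<open>U\<close> in
    \<open>A \<inter> N\<close> would form with it a union of \<open>2 * s + 1 = card B - q\<close>
    points, which is too many.\<close>
  have "R \<inter> N = {}"
  proof (rule equals0I)
    fix T assume "T \<in> R \<inter> N"
    then obtain U where T: "T \<subseteq> B" "card T = s" "T \<in> N" and U: "U \<in> A" "U \<in> N" "U \<inter> T = {}"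
      by (auto simp: R_def)
    then have "card (U \<union> T) = t + s"
      using finB finite_subset by (subst card_Un_disjoint) (auto simp: A_def)
    then show False using N[OF U(2) T(3)] B by (simp add: t_def)
  qed
  have L_le: "L * fact (card V) \<le> real (card ?E) * real (card V choose t)"
    unfolding L_def t_def
  proof (rule card_prefix_event_ge[OF V])
    fix xs assume xs: "xs \<in> permutations_of_set V"
    {
      assume "set (take (Suc s) xs) \<in> A - N"
      then have "set (take (Suc s) xs) \<in> Pow B - N" by (auto simp: A_def)
      then show "xs \<in> ?E" using xs by blast
    }
    {
      assume "set (take s xs) \<in> R"
      then have "set (take s xs) \<in> Pow B - N"
        using \<open>R \<inter> N = {}\<close> by (auto simp: R_def)
      then show "xs \<in> ?E" using xs by blast
    }
  qed (use sV in \<open>auto simp: A_def R_def t_def\<close>)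
  define w where "w = lym_weight (card V) q"
  have Vt: "real (card V choose t) > 0" using sV by (simp add: t_def)
  have w_t: "w t = real (card B choose t) / real (card V choose t)"
    using B by (simp add: w_def lym_weight_def t_def)
  have cardAN: "real (card (A - N)) = real (card B choose t) - real (card (A \<inter> N))"
    using finA cardA card_mono[of A "A \<inter> N"] by (simp add: card_Diff_subset_Int)
  have direct: ?thesis if "real (card B choose t) \<le> L"
  proof -
    have "real (card B choose t) * fact (card V) \<le> L * fact (card V)"
      using that by (intro mult_right_mono) auto
    also note L_le
    finally have "w t * fact (card V) \<le> real (card ?E)"
      using Vt unfolding w_t by (simp add: pos_divide_le_eq)
    then show ?thesis
      using sV by (intro exI[of _ t]) (simp add: w_def t_def)
  qed
  show ?thesis
  proof (cases "s = 0")
    \<comment> \<open>Singletons cannot meet in two points, so all of them are private.\<close>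
    case True
    have "A \<inter> N = {}"
    proof (rule equals0I)
      fix S assume S: "S \<in> A \<inter> N"
      then have "card S = 1" using True by (simp add: A_def t_def)
      then show False using two[OF S S] by simp
    qed
    then have "real (card B choose t) \<le> L"
      using cardAN BV by (simp add: L_def)
    then show ?thesis by (rule direct)
  next
    case False
    then have s: "1 \<le> s" by simp
    have "card (A \<inter> N) * (card B - 1) \<le> (t - 1) * (card B choose t)"
      using two finB B by (intro card_two_intersecting_le) (auto simp: A_def t_def)
    then have "real (card (A \<inter> N) * (card B - 1)) \<le> real ((t - 1) * (card B choose t))"
      by (simp only: of_nat_le_iff)
    then have N_le: "real (card (A \<inter> N)) * (2 * real t + real q - 2) \<le> (real t - 1) * real (card B choose t)"
      using B by (simp add: t_def del: binomial_Suc_Suc)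
    define disj where "disj T = {U \<in> A \<inter> N. U \<inter> T = {}}" for T
    have disj_sub: "U \<subseteq> B - T \<and> card U = t" if "U \<in> disj T" for U T
      using that by (auto simp: disj_def A_def)
    have card_comp: "card (B - T) = t + q" if "T \<in> R" for T
    proof -
      have "T \<subseteq> B" "card T = s" using that by (auto simp: R_def)
      then show ?thesis
        using finB B finite_subset[of T B] by (simp add: card_Diff_subset t_def)
    qed
    \<comment> \<open>Every \<open>s\<close>-subset of \<open>B - U\<close> belongs to
      \<open>R\<close> by definition, so each \<open>U\<close> has the same number of
      partners.\<close>
    have "card (A \<inter> N) * ((t + q - 1) choose s) = (\<Sum>U\<in>A \<inter> N. card {T \<in> R. U \<inter> T = {}})"
    proof -
      have "card {T \<in> R. U \<inter> T = {}} = (t + q - 1) choose s" if U: "U \<in> A \<inter> N" for U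
      proof -
        have "{T \<in> R. U \<inter> T = {}} = {T. T \<subseteq> B - U \<and> card T = s}"
          using U by (auto simp: R_def)
        moreover have "card (B - U) = t + q - 1"
          using U finB B finite_subset[of U B] by (auto simp: card_Diff_subset t_def A_def)
        ultimately show ?thesis
          using n_subsets[of "B - U" s] finB by simp
      qed
      then show ?thesis by simp
    qed
    also have "\<dots> = (\<Sum>U\<in>A \<inter> N. \<Sum>T\<in>R. of_bool (U \<inter> T = {}))"
      using finR by (simp add: Int_def)
    also have "\<dots> = (\<Sum>T\<in>R. \<Sum>U\<in>A \<inter> N. of_bool (U \<inter> T = {}))"
      by (rule sum.swap)
    also have "\<dots> = (\<Sum>T\<in>R. card (disj T))"
      using finA by (simp add: Int_def disj_def)
    finally have count: "card (A \<inter> N) * ((t + q - 1) choose s) = (\<Sum>T\<in>R. card (disj T))" .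
    define C where "C = (t + q - 1) choose s"
    have "C > 0" by (simp add: C_def t_def)
    have Ct: "t * ((t + q) choose t) = (t + q) * C"
      using times_binomial_minus1_eq[of t "t + q"] by (simp add: t_def C_def)
    \<comment> \<open>Trivial upper count: the partners of \<open>T\<close> are among all
      \<open>t\<close>-subsets of \<open>B - T\<close>.\<close>
    have "(\<Sum>T\<in>R. card (disj T)) \<le> (\<Sum>T\<in>R. (t + q) choose t)"
    proof (rule sum_mono)
      fix T assume T: "T \<in> R"
      have "disj T \<subseteq> {U. U \<subseteq> B - T \<and> card U = t}"
        using disj_sub by blast
      then have "card (disj T) \<le> card {U. U \<subseteq> B - T \<and> card U = t}"
        using finB by (intro card_mono) auto
      then show "card (disj T) \<le> (t + q) choose t"
        using n_subsets[of "B - T" t] finB card_comp[OF T] by simp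
    qed
    then have "card (A \<inter> N) * C \<le> card R * ((t + q) choose t)"
      using count by (simp add: C_def)
    then have "t * (card (A \<inter> N) * C) \<le> card R * (t * ((t + q) choose t))"
      by (metis mult.left_commute mult_le_mono2)
    then have "card (A \<inter> N) * t \<le> card R * (t + q)"
      using \<open>C > 0\<close> unfolding Ct by (simp add: mult.left_commute mult.commute)
    then have NR: "real (card (A \<inter> N)) * real t \<le> real (card R) * (real t + real q)"
      by (metis of_nat_add of_nat_le_iff of_nat_mult)
    have NR': "real (card (A \<inter> N)) * (real t * (real t + real q - 1))
        \<le> real (card R) * ((real t + real q) * (real t - 1))" if "real t \<le> real q + 1"
    proof -
      have "t \<le> q + 1" using that by linarith
      have "(\<Sum>T\<in>R. card (disj T) * (t + q - 1)) \<le> (\<Sum>T\<in>R. (t - 1) * ((t + q) choose t))"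
      proof (rule sum_mono)
        fix T assume T: "T \<in> R"
        \<comment> \<open>The partners of \<open>T\<close> meet pairwise in two points. On the
          \<open>t + q\<close> points of \<open>B - T\<close> the sharper bound requires
          \<open>2 * t <= t + q + 1\<close>, that is \<open>t <= q + 1\<close>.\<close>
        have "card (disj T) * (card (B - T) - 1) \<le> (t - 1) * (card (B - T) choose t)"
          using two finB card_comp[OF T] \<open>t \<le> q + 1\<close> disj_sub
          by (intro card_two_intersecting_le) (auto simp: disj_def)
        then show "card (disj T) * (t + q - 1) \<le> (t - 1) * ((t + q) choose t)"
          using card_comp[OF T] by simp
      qed
      then have "card (A \<inter> N) * C * (t + q - 1) \<le> card R * (t - 1) * ((t + q) choose t)"
        using count by (simp add: C_def sum_distrib_right[symmetric])
      then have "t * (card (A \<inter> N) * C * (t + q - 1)) \<le> card R * (t - 1) * (t * ((t + q) choose t))"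
        by (metis mult.left_commute mult_le_mono2)
      then have "C * (card (A \<inter> N) * (t * (t + q - 1))) \<le> C * (card R * ((t + q) * (t - 1)))"
        unfolding Ct by (simp add: ac_simps)
      then have "card (A \<inter> N) * (t * (t + q - 1)) \<le> card R * ((t + q) * (t - 1))"
        using \<open>C > 0\<close> by simp
      then have "real (card (A \<inter> N) * (t * (t + q - 1))) \<le> real (card R * ((t + q) * (t - 1)))"
        by (simp only: of_nat_le_iff)
      then show ?thesis by (simp add: t_def algebra_simps)
    qed
    have "real (card B choose t) \<le> L \<or>
      real (card B choose t) * ((real t + real q - 1) * (real (card V) - real t + 1))
        \<le> L * ((2 * real t + real q - 1) * (2 * real t + real q - 2))"
    proof -
      have "L = real (card B choose t) - real (card (A \<inter> N))
          + real (card R) * (real (card V) - (2 * real t + real q - 1)) / real t"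
        unfolding L_def cardAN using B by (simp add: t_def)
      moreover have "real (3 * t + q) \<le> real (card V + 1) \<or> real (card V + 2) \<le> real (3 * t + q)"
        unfolding of_nat_le_iff by linarith
      then have "3 * real t + real q - 1 \<le> real (card V) \<or> real (card V) \<le> 3 * real t + real q - 2"
        by auto
      moreover have "real t \<le> real (q + 1) \<or> real (q + 2) \<le> real t"
        unfolding of_nat_le_iff by linarith
      then have "real t \<le> real q + 1 \<or> real q + 2 \<le> real t"
        by (simp add: add.commute)
      ultimately show ?thesis
        using odd_block_numeric[of "real t" "real q" "real (card V)" "real (card B choose t)"
            "real (card (A \<inter> N))" "real (card R)"] N_le NR NR' B BV s
        by (simp add: t_def del: binomial_Suc_Suc)
    qed
    then show ?thesis
    proof
      assume *: "real (card B choose t) * ((real t + real q - 1) * (real (card V) - real t + 1))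
        \<le> L * ((2 * real t + real q - 1) * (2 * real t + real q - 2))"
      define c where "c = (2 * real t + real q - 1) * (2 * real t + real q - 2)"
      have "c > 0" using s by (simp add: c_def t_def)
      \<comment> \<open>The recurrence turns the second alternative, stated with the block's
        \<open>t\<close>-subsets, into the weight at \<open>s = t - 1\<close>.\<close>
      have "w s * c = w t * ((real t + real q - 1) * (real (card V) - real t + 1))"
        using lym_weight_Suc[of s "card V" q] sV s by (simp add: w_def c_def t_def algebra_simps)
      then have "w s * c * real (card V choose t) \<le> L * c"
        using * Vt unfolding c_def[symmetric] w_t by (simp add: field_simps)
      then have "w s * real (card V choose t) \<le> L"
        using \<open>c > 0\<close> by (simp add: mult.commute mult.left_commute)
      then have "w s * real (card V choose t) * fact (card V) \<le> L * fact (card V)"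
        by (intro mult_right_mono) auto
      also note L_le
      finally have "(w s * fact (card V)) * real (card V choose t)
          \<le> real (card ?E) * real (card V choose t)"
        by (simp only: mult_ac)
      then have "w s * fact (card V) \<le> real (card ?E)"
        using Vt by (rule mult_right_le_imp_le)
      then show ?thesis
        using sV s by (intro exI[of _ s]) (simp add: w_def)
    qed (rule direct)
  qed
qed

lemma prefix_event_lym_weight_tstar:
  assumes V: "finite V" "B \<subseteq> V" and B: "q < card B"
    and N: "\<And>S T. S \<in> N \<Longrightarrow> T \<in> N \<Longrightarrow> card (S \<union> T) + q < card B"
  shows "lym_weight (card V) q (tstar (card V) q) * fact (card V)
    \<le> real (card {xs \<in> permutations_of_set V. \<exists>j. set (take j xs) \<in> Pow B - N})"
    (is "_ \<le> real (card ?E)")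
proof -
  define r where "r = card B - q - 1"
  have r: "card B = r + q + 1" using B by (simp add: r_def)
  have "\<exists>t\<le>card V. 0 < t + q \<and> lym_weight (card V) q t * fact (card V) \<le> real (card ?E)"
  proof (cases "even r")
    case True
    then obtain s where "r = 2 * s" by blast
    then show ?thesis
      using prefix_event_lym_weight_odd[OF V, of s q N] r N by simp
  next
    case False
    then obtain s where "r = 2 * s + 1" by (elim oddE)
    then have B': "card B = 2 * Suc s + q" using r by simp
    then have "Suc s \<le> card V" using card_mono[OF V] by simp
    then show ?thesis
      using prefix_event_lym_weight_even[OF V B' N] by blast
  qed
  then obtain t where t: "t \<le> card V" "0 < t + q"
    and le: "lym_weight (card V) q t * fact (card V) \<le> real (card ?E)" by blast
  have "lym_weight (card V) q (tstar (card V) q) * fact (card V)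
      \<le> lym_weight (card V) q t * fact (card V)"
    using lym_weight_tstar_le[OF t] by (intro mult_right_mono) auto
  then show ?thesis using le by linarith
qed

section \<open>The bound\<close>

text \<open>An LYM argument: the events \<open>E c\<close> are disjoint sets of permutations, each
  of at least the minimal weight.\<close>

lemma card_family_lym_weight_tstar_le_1:
  fixes B :: "'i \<Rightarrow> 'a set"
  assumes V: "finite V" and I: "finite I" and BV: "\<And>c. c \<in> I \<Longrightarrow> B c \<subseteq> V"
    and sep: "\<And>c J. c \<in> I \<Longrightarrow> J \<subseteq> I - {c} \<Longrightarrow> card J \<le> 2 \<Longrightarrow> q < card (B c - \<Union> (B ` J))"
  shows "real (card I) * lym_weight (card V) q (tstar (card V) q) \<le> 1"
proof -
  define N where "N c = {T. T \<subseteq> B c \<and> (\<exists>a\<in>I - {c}. T \<subseteq> B a)}" for c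
  define E where "E c = {xs \<in> permutations_of_set V. \<exists>j. set (take j xs) \<in> Pow (B c) - N c}" for c
  define w where "w = lym_weight (card V) q (tstar (card V) q)"
  have E_ge: "w * fact (card V) \<le> real (card (E c))" if c: "c \<in> I" for c
    unfolding E_def w_def
  proof (rule prefix_event_lym_weight_tstar)
    show "q < card (B c)" using sep[OF c, of "{}"] by simp
  next
    fix S T assume "S \<in> N c" "T \<in> N c"
    then obtain a b where ab: "a \<in> I - {c}" "b \<in> I - {c}" and ST: "S \<subseteq> B c \<inter> B a" "T \<subseteq> B c \<inter> B b"
      by (auto simp: N_def)
    have fin: "finite (B c)" using BV[OF c] V finite_subset by blast
    \<comment> \<open>Two non-private sets are covered by at most two other blocks, which leave more
      than \<open>q\<close> points of \<open>B c\<close> uncovered.\<close>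
    have "q < card (B c - \<Union> (B ` {a, b}))"
      using ab card_insert_le_m1[of 2 "{b}" a] by (intro sep[OF c]) auto
    also have "\<dots> \<le> card (B c - (S \<union> T))"
      using ST fin by (intro card_mono) auto
    also have "\<dots> = card (B c) - card (S \<union> T)"
      using ST fin by (intro card_Diff_subset) (auto intro: finite_subset)
    finally show "card (S \<union> T) + q < card (B c)" by simp
  qed (use V BV[OF c] in auto)
  have "E c \<inter> E d = {}" if "c \<in> I" "d \<in> I" "c \<noteq> d" for c d
  proof (rule equals0I)
    fix xs assume "xs \<in> E c \<inter> E d"
    then obtain i j where i: "set (take i xs) \<in> Pow (B c) - N c" and j: "set (take j xs) \<in> Pow (B d) - N d"
      by (auto simp: E_def)
    \<comment> \<open>The smaller of two nested prefixes would lie in both blocks and be private to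
      neither.\<close>
    have "set (take i xs) \<subseteq> set (take j xs) \<or> set (take j xs) \<subseteq> set (take i xs)"
      using set_take_subset_set_take[of i j xs] set_take_subset_set_take[of j i xs] by linarith
    then show False
      using i j that unfolding N_def by blast
  qed
  then have "card (\<Union>c\<in>I. E c) = (\<Sum>c\<in>I. card (E c))"
    using I by (intro card_UN_disjoint) (auto simp: E_def)
  moreover have "(\<Union>c\<in>I. E c) \<subseteq> permutations_of_set V"
    by (auto simp: E_def)
  then have "card (\<Union>c\<in>I. E c) \<le> fact (card V)"
    using card_mono[of "permutations_of_set V" "\<Union>c\<in>I. E c"] V by simp
  ultimately have "real (\<Sum>c\<in>I. card (E c)) \<le> real (fact (card V))"
    by (simp only: of_nat_le_iff)
  then have "(\<Sum>c\<in>I. real (card (E c))) \<le> fact (card V)"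
    by simp
  moreover have "real (card I) * (w * fact (card V)) \<le> (\<Sum>c\<in>I. real (card (E c)))"
    using sum_mono[OF E_ge] by simp
  ultimately have "(real (card I) * w) * fact (card V) \<le> 1 * fact (card V)"
    unfolding mult.assoc mult_1_left by (rule order_trans[rotated])
  then show ?thesis
    unfolding w_def by (rule mult_right_le_imp_le) simp
qed

section \<open>From designs to families of blocks\<close>

text \<open>Compare \<open>J\<close> with \<open>insert c J\<close>: the two unions are nested, so
  their symmetric difference is the part of \<open>B c\<close> missed by \<open>J\<close>.\<close>

lemma pq_solution_separated:
  assumes "pq_solution p q n D" and "c \<in> {1..n}" and "J \<subseteq> {1..n} - {c}" and "card J \<le> p"
  defines "B \<equiv> \<lambda>i. design_dual n D ! (i - 1)"
  shows "q < card (B c - \<Union> (B ` J))"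
proof -
  have "J \<subseteq> {1..n}" "insert c J \<subseteq> {1..n}" "J \<noteq> insert c J"
    using assms by auto
  then have "q < card (sym_diff (phi (design_dual n D) J) (phi (design_dual n D) (insert c J)))"
    using assms(1,4) unfolding pq_solution_def by blast
  also have "sym_diff (phi (design_dual n D) J) (phi (design_dual n D) (insert c J)) = B c - \<Union> (B ` J)"
    by (auto simp: phi_def B_def)
  finally show ?thesis .
qed

text \<open>The fraction vanishes as \<open>q(q-1) = 0\<close>. For \<open>q = 0\<close> the
  condition \<open>v >= 3\<close> rules out \<open>t = 0\<close> by the inequality itself; for
  \<open>v = 1\<close> and \<open>v = 2\<close> the ceiling is 0 but \<open>tstar\<close> is
  1.\<close>

lemma tstar_eq_ceiling:
  assumes "q = 1 \<or> (q = 0 \<and> v \<ge> 3)"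
  shows "int (tstar v q) = \<lceil>(real v - 2) / 5\<rceil>"
proof -
  have ineq: "tstar_ineq v q t \<longleftrightarrow> real v \<le> 5 * real t + 2" for t
    using assms by (auto simp: tstar_ineq_def)
  have le: "real v \<le> 5 * real (tstar v q) + 2"
    using tstar_ineq_tstar ineq by blast
  show ?thesis
  proof (rule ceiling_unique[symmetric])
    show "(real v - 2) / 5 \<le> real_of_int (int (tstar v q))"
      using le by simp
    show "real_of_int (int (tstar v q)) - 1 < (real v - 2) / 5"
    proof (cases "tstar v q")
      case 0
      then show ?thesis by simp
    next
      case (Suc t)
      then have "\<not> tstar_ineq v q t"
        using tstar_le[of v q t] by auto
      then show ?thesis using ineq Suc by simp
    qed
  qed
qed

theorem theorem2:
  fixes v q n :: nat and D :: "nat set list"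
  assumes "v \<ge> 1"
    and "is_design v n D"
    and "design_dual n D \<in> dual_solutions v 2 q"
  shows "real n \<le> real (v choose tstar v q)
             * inverse (real ((2 * tstar v q + q - 1) choose tstar v q))
         \<and> (q = 1 \<or> (q = 0 \<and> v \<ge> 3) \<longrightarrow> int (tstar v q) = \<lceil>(real v - 2) / 5\<rceil>)"
proof
  define B where "B i = design_dual n D ! (i - 1)" for i
  define t where "t = tstar v q"
  \<comment> \<open>Membership only provides some design with the same dual; the length of the dual
    recovers \<open>n\<close>, and the solution property depends only on \<open>n\<close> and the
    dual.\<close>
  obtain n' D' where dual: "design_dual n D = design_dual n' D'" and sol: "pq_solution 2 q n' D'"
    using assms(3) by (auto simp: dual_solutions_def)
  have "n = n'"
    using arg_cong[OF dual, of length] by (simp add: design_dual_def del: upt_Suc)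
  then have "pq_solution 2 q n D"
    using dual sol by (simp add: pq_solution_def)
  then have sep: "q < card (B c - \<Union> (B ` J))"
    if "c \<in> {1..n}" "J \<subseteq> {1..n} - {c}" "card J \<le> 2" for c J
    unfolding B_def using that by (rule pq_solution_separated)
  have BV: "B c \<subseteq> {1..v}" if "c \<in> {1..n}" for c
    using that assms(2) by (auto simp: B_def design_dual_def is_design_def simp del: upt_Suc)
  have le: "real n * lym_weight v q t \<le> 1"
    using card_family_lym_weight_tstar_le_1[of "{1..v}" "{1..n}" B q] sep BV by (simp add: t_def)
  have tq: "0 < t + q"
    using tstar_ineq_tstar[of v q] by (simp add: tstar_ineq_def t_def)
  \<comment> \<open>At \<open>t = v\<close> the factor \<open>v - t\<close> vanishes. Hence
    \<open>tstar\<close> is at most \<open>v\<close>, and the binomial \<open>v choose t\<close> is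
    positive.\<close>
  have "tstar_ineq v q v"
    using assms(1) by (simp add: tstar_ineq_iff)
  then have "t \<le> v"
    unfolding t_def by (rule tstar_le)
  then have "real (v choose t) > 0" "real ((2 * t + q - 1) choose t) > 0"
    using tq by auto
  then show "real n \<le> real (v choose tstar v q)
      * inverse (real ((2 * tstar v q + q - 1) choose tstar v q))"
    using le unfolding t_def[symmetric] lym_weight_def by (simp add: field_simps)
  show "q = 1 \<or> (q = 0 \<and> v \<ge> 3) \<longrightarrow> int (tstar v q) = \<lceil>(real v - 2) / 5\<rceil>"
    using tstar_eq_ceiling by blast
qed

end
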